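(* Let $\mathcal{C}$ be a binary linear code of minimum distance $d\le 2$. Then for every parity-check matrix $H$ of $\mathcal{C}$ we have $d=w^{\min}(H)$, where $w^{\min}$ is any one of the minimum AWGNC pseudoweight, the minimum BSC pseudoweight, or the minimum max-fractional weight.
   Context: A binary linear code of length $n$ is a linear subspace $\mathcal{C}\subseteq\mathbb{F}_2^n$; its minimum (Hamming) distance $d$ is the smallest weight of a nonzero codeword ($\mathcal{C}$ is nonzero). A parity-check matrix of $\mathcal{C}$ is any $m\times n$ matrix $H$ over $\mathbb{F}_2$ (any $m\ge 0$, redundant rows allowed) with $\mathcal{C}=\ker H=\{c\in\mathbb{F}_2^n : Hc^T=0\}$. Put $\mathcal{I}=\{1,\dots,n\}$, $\mathcal{J}=\{1,\dots,m\}$, and $\mathcal{I}_j=\{i\in\mathcal{I}: H_{j,i}\ne 0\}$ for $j\in\mathcal{J}$. The fundamental cone $\mathcal{K}(H)$ is the set of $x\in\mathbb{R}^n$ with $x_i\ge 0$ for all $i\in\mathcal{I}$ and $x_\ell\le\sum_{i\in\mathcal{I}_j\setminus\{\ell\}}x_i$ for all $j\in\mathcal{J}$, $\ell\in\mathcal{I}_j$ (an empty sum is $0$). For nonzero $x\in\mathcal{K}(H)$ define: $w_{\mathrm{AWGNC}}(x)=\left(\sum_i x_i\right)^2/\sum_i x_i^2$; $w_{\mathrm{maxfrac}}(x)=\left(\sum_i x_i\right)/\max_i x_i$; and $w_{\mathrm{BSC}}(x)=2\,\Phi^{-1}(\Phi(n)/2)$, where $x'$ is $x$ with its components rearranged in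 non-increasing order, $\phi(\xi)=x'_i$ for $i-1<\xi\le i$ ($1\le i\le n$), and $\Phi(\xi)=\int_0^\xi\phi(\xi')\,d\xi'$ (i.e. $\Phi^{-1}(\Phi(n)/2)$ is the unique $\xi\in[0,n]$ with $\Phi(\xi)=\Phi(n)/2$). For each type of weight $w$, the minimum pseudoweight is $w^{\min}(H)=\min_{x\in\mathcal{K}(H)\setminus\{0\}}w(x)$. *)

theory Defs
  imports
    "HOL-Analysis.Henstock_Kurzweil_Integration"
    "HOL-Library.Z2"
    "Jordan_Normal_Form.Matrix_Kernel"
begin

text \<open>
  Binary vectors and matrices have entries in the two-element field \<^typ>\<open>bit\<close>. Vectors and
  matrices carry their dimensions as values, so that matrices without rows are included; all
  indices start at 0.
\<close>

definition binary_linear_code :: "nat \<Rightarrow> bit vec set \<Rightarrow> bool" where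
  "binary_linear_code n C \<longleftrightarrow> VectorSpace.subspace class_ring C (module_vec TYPE(bit) n)"

definition hamming_weight :: "bit vec \<Rightarrow> nat" where
  "hamming_weight c = card {i. i < dim_vec c \<and> c $ i \<noteq> 0}"

definition min_distance :: "bit vec set \<Rightarrow> nat" where
  "min_distance C = Min (hamming_weight ` {c \<in> C. c \<noteq> 0\<^sub>v (dim_vec c)})"

definition parity_check_matrix :: "nat \<Rightarrow> nat \<Rightarrow> bit mat \<Rightarrow> bit vec set \<Rightarrow> bool" where
  "parity_check_matrix m n H C \<longleftrightarrow> H \<in> carrier_mat m n \<and> C = mat_kernel H"

definition row_support :: "bit mat \<Rightarrow> nat \<Rightarrow> nat set" where
  "row_support H j = {i. i < dim_col H \<and> H $$ (j, i) \<noteq> 0}"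

definition fundamental_cone :: "bit mat \<Rightarrow> real vec set" where
  "fundamental_cone H =
    {x \<in> carrier_vec (dim_col H).
      (\<forall>i < dim_col H. 0 \<le> x $ i) \<and>
      (\<forall>j < dim_row H. \<forall>l \<in> row_support H j. x $ l \<le> (\<Sum>i \<in> row_support H j - {l}. x $ i))}"

definition awgnc_weight :: "real vec \<Rightarrow> real" where
  "awgnc_weight x = (\<Sum>i < dim_vec x. x $ i)\<^sup>2 / (\<Sum>i < dim_vec x. (x $ i)\<^sup>2)"

definition maxfrac_weight :: "real vec \<Rightarrow> real" where
  "maxfrac_weight x = (\<Sum>i < dim_vec x. x $ i) / Max ((\<lambda>i. x $ i) ` {..< dim_vec x})"

definition rearranged :: "real vec \<Rightarrow> real list" where
  "rearranged x = rev (sort (list_of_vec x))"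

text \<open>
  The step function takes the value of the \<open>i\<close>-th largest component on the interval
  \<open>(i - 1, i]\<close>, where \<open>i = \<lceil>\<xi>\<rceil>\<close> counts from 1 while list positions count from 0. The value 0
  outside \<open>(0, n]\<close> is a dummy that does not affect the integrals below.
\<close>

definition bsc_phi :: "real vec \<Rightarrow> real \<Rightarrow> real" where
  "bsc_phi x \<xi> =
    (if 0 < \<xi> \<and> \<xi> \<le> real (dim_vec x) then rearranged x ! (nat \<lceil>\<xi>\<rceil> - 1) else 0)"

definition bsc_Phi :: "real vec \<Rightarrow> real \<Rightarrow> real" where
  "bsc_Phi x \<xi> = integral {0..\<xi>} (bsc_phi x)"

text \<open>
  The function \<^const>\<open>bsc_Phi\<close> need not be injective on \<open>[0, n]\<close> (it is constant where the
  rearranged components vanish), but for nonzero nonnegative \<open>x\<close> half of its final value is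
  attained exactly once.
\<close>

definition bsc_weight :: "real vec \<Rightarrow> real" where
  "bsc_weight x =
    2 * (THE \<xi>. 0 \<le> \<xi> \<and> \<xi> \<le> real (dim_vec x) \<and> bsc_Phi x \<xi> = bsc_Phi x (real (dim_vec x)) / 2)"

text \<open>
  The minimum pseudoweight is a predicate on its value, so that asserting it includes the claim
  that the minimum over the nonzero points of the (infinite) cone is attained.
\<close>

definition is_min_pseudoweight :: "(real vec \<Rightarrow> real) \<Rightarrow> bit mat \<Rightarrow> real \<Rightarrow> bool" where
  "is_min_pseudoweight w H v \<longleftrightarrow>
    (\<exists>x \<in> fundamental_cone H - {0\<^sub>v (dim_col H)}. w x = v) \<and>
    (\<forall>x \<in> fundamental_cone H - {0\<^sub>v (dim_col H)}. v \<le> w x)"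

end

theory Submission
  imports Defs
begin

text \<open>
  A codeword meets every check in an even number of positions, so its real indicator vector lies in
  the fundamental cone, and all three weights of that vector equal the Hamming weight. Conversely
  the max-fractional weight is a lower bound for the other two, because
  \<open>\<Sum>\<^sub>i x\<^sub>i\<^sup>2 \<le> max x \<cdot> \<Sum>\<^sub>i x\<^sub>i\<close> and \<open>\<Phi>(\<xi>) \<le> \<xi> \<cdot> max x\<close>. It is at
  least 1 trivially, and at least 2 if every coordinate \<open>l\<close> takes part in some check, because that
  check gives \<open>2 x\<^sub>l \<le> \<Sum>\<^sub>i x\<^sub>i\<close>. A coordinate taking part in no check would yield a
  codeword of weight 1.
\<close>

section \<open>The rearranged vector\<close>

lemma length_rearranged [simp]: "length (rearranged x) = dim_vec x"
  by (simp add: rearranged_def)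

lemma set_rearranged: "set (rearranged x) = ($) x ` {..< dim_vec x}"
  by (force simp: rearranged_def in_set_conv_nth list_of_vec_index)

lemma rearranged_antimono:
  "i \<le> j \<Longrightarrow> j < dim_vec x \<Longrightarrow> rearranged x ! j \<le> rearranged x ! i"
  using sorted_rev_nth_mono[of "rearranged x" i j] length_rearranged[of x]
  by (simp add: rearranged_def)

lemma sum_rearranged: "(\<Sum>i < dim_vec x. rearranged x ! i) = (\<Sum>i < dim_vec x. x $ i)"
proof -
  have "(\<Sum>i < dim_vec x. rearranged x ! i) = sum_list (rearranged x)"
    by (simp add: sum_list_sum_nth atLeast0LessThan)
  also have "\<dots> = sum_list (list_of_vec x)"
    \<comment> \<open>Read as sums over multisets, both sides agree, since sorting and reversing
      only permute the entries.\<close>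
    by (simp add: rearranged_def flip: sum_mset_sum_list)
  also have "\<dots> = (\<Sum>i < dim_vec x. x $ i)"
    by (simp add: sum_list_sum_nth atLeast0LessThan list_of_vec_index)
  finally show ?thesis .
qed

section \<open>The BSC weight\<close>

lemma bsc_phi_in:
  assumes "0 < \<xi>" "\<xi> \<le> real (dim_vec x)"
  shows "bsc_phi x \<xi> \<in> ($) x ` {..< dim_vec x}"
proof -
  \<comment> \<open>The ceiling lies between 1 and n, so the list position lies between 0 and n -
    1.\<close>
  have "nat \<lceil>\<xi>\<rceil> - 1 < dim_vec x" using assms by linarith
  then show ?thesis
    using assms nth_mem[of "nat \<lceil>\<xi>\<rceil> - 1" "rearranged x"] unfolding set_rearranged
    by (simp add: bsc_phi_def)
qed

lemma bsc_phi_antimono: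
  assumes "0 < a" "a \<le> b" "b \<le> real (dim_vec x)"
  shows "bsc_phi x b \<le> bsc_phi x a"
proof -
  have "nat \<lceil>a\<rceil> - 1 \<le> nat \<lceil>b\<rceil> - 1" using assms by (intro diff_le_mono nat_mono ceiling_mono)
  moreover have "nat \<lceil>b\<rceil> - 1 < dim_vec x" using assms by linarith
  ultimately show ?thesis
    using assms by (simp add: bsc_phi_def rearranged_antimono)
qed

text \<open>Each unit interval contributes one entry of the sorted list, so at integer points \<Phi>
  is a partial sum.\<close>

lemma has_integral_bsc_phi:
  "k \<le> dim_vec x \<Longrightarrow> (bsc_phi x has_integral (\<Sum>i<k. rearranged x ! i)) {0..real k}"
proof (induction k)
  case 0
  then show ?case by (simp add: has_integral_refl)
next
  case (Suc k)
  have "((\<lambda>_. rearranged x ! k) has_integral rearranged x ! k) {real k..real (Suc k)}"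
    using has_integral_const_real[of "rearranged x ! k" "real k" "real (Suc k)"] by simp
  \<comment> \<open>The ceiling is k + 1 on (k, k + 1]. The left end is exempted: its ceiling is k,
    and for k = 0 the dummy value 0 is taken there.\<close>
  then have "(bsc_phi x has_integral rearranged x ! k) {real k..real (Suc k)}"
  proof (rule has_integral_spike_finite[of "{real k}", rotated 2])
    fix t assume t: "t \<in> {real k..real (Suc k)} - {real k}"
    then have "\<lceil>t\<rceil> = int k + 1" by (intro ceiling_unique) auto
    then have "nat \<lceil>t\<rceil> - 1 = k" by simp
    then show "bsc_phi x t = rearranged x ! k"
      using t Suc.prems by (auto simp: bsc_phi_def)
  qed simp
  then show ?case
    using has_integral_combine[of 0 "real k" "real (Suc k)" "bsc_phi x"] Suc by simp
qed

lemma bsc_phi_integrable: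
  assumes "0 \<le> a" "b \<le> real (dim_vec x)"
  shows "bsc_phi x integrable_on {a..b}"
  using has_integral_bsc_phi[of "dim_vec x" x] assms
  by (auto intro: integrable_on_subinterval)

lemma bsc_Phi_total: "bsc_Phi x (real (dim_vec x)) = (\<Sum>i < dim_vec x. x $ i)"
  using has_integral_bsc_phi[of "dim_vec x" x] sum_rearranged[of x]
  by (simp add: bsc_Phi_def integral_unique)

lemma bsc_Phi_split:
  assumes "0 \<le> a" "a \<le> b" "b \<le> real (dim_vec x)"
  shows "bsc_Phi x b = bsc_Phi x a + integral {a..b} (bsc_phi x)"
  unfolding bsc_Phi_def using assms
  by (intro Henstock_Kurzweil_Integration.integral_combine[symmetric] bsc_phi_integrable) auto

text \<open>The predicate under the definite description in \<open>bsc_weight\<close>, named so that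
  existence and uniqueness can be treated separately.\<close>

definition bsc_half_point :: "real vec \<Rightarrow> real \<Rightarrow> bool" where
  "bsc_half_point x \<xi> \<longleftrightarrow>
    0 \<le> \<xi> \<and> \<xi> \<le> real (dim_vec x) \<and> bsc_Phi x \<xi> = bsc_Phi x (real (dim_vec x)) / 2"

text \<open>Half of a positive total is still to be gained to the right of \<xi>. Since
  \<open>bsc_phi\<close> is antitone on (0, n], a nonpositive value at \<xi> would leave nothing to
  gain.\<close>

lemma bsc_half_point_pos:
  assumes pos: "0 < (\<Sum>i < dim_vec x. x $ i)" and half: "bsc_half_point x \<xi>"
  shows "0 < \<xi>" and "0 < bsc_phi x \<xi>"
proof -
  let ?n = "real (dim_vec x)"
  have \<xi>: "0 \<le> \<xi>" "\<xi> \<le> ?n" "bsc_Phi x \<xi> = bsc_Phi x ?n / 2" and "0 < bsc_Phi x ?n"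
    using half pos by (auto simp: bsc_half_point_def bsc_Phi_total)
  have "bsc_Phi x 0 = 0" by (simp add: bsc_Phi_def)
  then show "0 < \<xi>" using \<xi> \<open>0 < bsc_Phi x ?n\<close> by (cases "\<xi> = 0") auto
  show "0 < bsc_phi x \<xi>"
  proof (rule ccontr)
    assume "\<not> 0 < bsc_phi x \<xi>"
    then have "bsc_phi x t \<le> 0" if "t \<in> {\<xi>..?n}" for t
      using bsc_phi_antimono[of \<xi> t x] that \<open>0 < \<xi>\<close> by auto
    then have "integral {\<xi>..?n} (bsc_phi x) \<le> integral {\<xi>..?n} (\<lambda>_. 0)"
      using \<xi> by (intro integral_le bsc_phi_integrable) auto
    then show False
      using bsc_Phi_split[of \<xi> ?n x] \<xi> \<open>0 < bsc_Phi x ?n\<close> by simp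
  qed
qed

text \<open>Intermediate value theorem for the continuous \<Phi>, which runs from 0 to the positive
  total.\<close>

lemma bsc_half_point_exists:
  assumes pos: "0 < (\<Sum>i < dim_vec x. x $ i)"
  shows "\<exists>\<xi>. bsc_half_point x \<xi>"
proof -
  let ?n = "real (dim_vec x)"
  have "continuous_on {0..?n} (bsc_Phi x)"
    unfolding bsc_Phi_def by (intro indefinite_integral_continuous_1 bsc_phi_integrable) auto
  moreover have "bsc_Phi x 0 = 0" by (simp add: bsc_Phi_def)
  ultimately show ?thesis
    using IVT'[of "bsc_Phi x" 0 "bsc_Phi x ?n / 2" ?n] pos
    by (auto simp: bsc_half_point_def bsc_Phi_total)
qed

text \<open>Of two half points a < b, the value of \<open>bsc_phi\<close> at b is positive and
  bounds it from below on [a, b]. Hence \<Phi> would grow strictly from a to b.\<close>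

lemma bsc_half_point_unique:
  assumes pos: "0 < (\<Sum>i < dim_vec x. x $ i)"
    and a: "bsc_half_point x a" and b: "bsc_half_point x b"
  shows "a = b"
proof -
  have False if "bsc_half_point x a" "bsc_half_point x b" "a < b" for a b
  proof -
    have ab: "0 < a" "b \<le> real (dim_vec x)" "bsc_Phi x a = bsc_Phi x b"
      using that bsc_half_point_pos(1)[OF pos that(1)] by (auto simp: bsc_half_point_def)
    have "integral {a..b} (\<lambda>_. bsc_phi x b) \<le> integral {a..b} (bsc_phi x)"
      using ab by (intro integral_le bsc_phi_integrable) (auto intro: bsc_phi_antimono)
    moreover have "0 < (b - a) * bsc_phi x b"
      using bsc_half_point_pos(2)[OF pos that(2)] \<open>a < b\<close> by simp
    ultimately show False
      using bsc_Phi_split[of a b x] ab \<open>a < b\<close> by simp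
  qed
  then show ?thesis using a b by (meson linorder_neqE_linordered_idom)
qed

text \<open>Eliminates the definite description: later arguments only use that the weight is twice
  some half point.\<close>

lemma bsc_weight_half_point:
  assumes "0 < (\<Sum>i < dim_vec x. x $ i)"
  obtains \<xi> where "bsc_half_point x \<xi>" and "bsc_weight x = 2 * \<xi>"
proof -
  obtain \<xi> where \<xi>: "bsc_half_point x \<xi>" using bsc_half_point_exists assms by blast
  have "(THE \<xi>. bsc_half_point x \<xi>) = \<xi>"
    using bsc_half_point_unique[OF assms] \<xi> by blast
  then show ?thesis
    using that[OF \<xi>] by (simp add: bsc_weight_def bsc_half_point_def)
qed

section \<open>The max-fractional weight as a lower bound\<close>

lemma Max_component_pos:
  fixes x :: "real vec"
  assumes "0 < (\<Sum>i < dim_vec x. x $ i)"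
  shows "0 < Max (($) x ` {..< dim_vec x})"
proof -
  obtain i where "i < dim_vec x" "0 < x $ i"
    using assms by (metis lessThan_iff not_le sum_nonpos)
  then show ?thesis by (subst Max_gr_iff) auto
qed

lemma maxfrac_le_awgnc:
  assumes nonneg: "\<And>i. i < dim_vec x \<Longrightarrow> 0 \<le> x $ i"
    and pos: "0 < (\<Sum>i < dim_vec x. x $ i)"
  shows "maxfrac_weight x \<le> awgnc_weight x"
proof -
  let ?S = "\<Sum>i < dim_vec x. x $ i" and ?Q = "\<Sum>i < dim_vec x. (x $ i)\<^sup>2"
    and ?M = "Max (($) x ` {..< dim_vec x})"
  have "0 < ?M" using Max_component_pos[OF pos] .
  have "?Q \<le> (\<Sum>i < dim_vec x. ?M * x $ i)"
    unfolding power2_eq_square using nonneg by (intro sum_mono mult_right_mono) auto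
  then have le: "?Q \<le> ?M * ?S" by (simp add: sum_distrib_left)
  have "0 < ?Q"
  proof -
    obtain i where "i < dim_vec x" "0 < x $ i"
      using pos by (metis lessThan_iff not_le sum_nonpos)
    then show ?thesis by (intro sum_pos2[of _ i]) auto
  qed
  \<comment> \<open>This is the claim S / M \<le> S^2 / Q with denominators cleared.\<close>
  have "?S * ?Q \<le> ?S * (?M * ?S)" using le pos by (intro mult_left_mono) auto
  then show ?thesis
    unfolding maxfrac_weight_def awgnc_weight_def
    using \<open>0 < ?M\<close> \<open>0 < ?Q\<close> by (simp add: field_simps power2_eq_square)
qed

lemma maxfrac_le_bsc:
  assumes pos: "0 < (\<Sum>i < dim_vec x. x $ i)"
  shows "maxfrac_weight x \<le> bsc_weight x"
proof -
  let ?S = "\<Sum>i < dim_vec x. x $ i" and ?M = "Max (($) x ` {..< dim_vec x})"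
  have "0 < ?M" using Max_component_pos[OF pos] .
  obtain \<xi> where half: "bsc_half_point x \<xi>" and w: "bsc_weight x = 2 * \<xi>"
    using bsc_weight_half_point[OF pos] .
  then have \<xi>: "0 \<le> \<xi>" "\<xi> \<le> real (dim_vec x)" "bsc_Phi x \<xi> = ?S / 2"
    by (auto simp: bsc_half_point_def bsc_Phi_total)
  have "bsc_phi x t \<le> ?M" if "t \<in> {0..\<xi>}" for t
  proof (cases "t = 0")
    case True
    \<comment> \<open>At 0 the dummy value 0 is taken, which need not be a component but lies below
      the positive maximum.\<close>
    then show ?thesis using \<open>0 < ?M\<close> by (simp add: bsc_phi_def)
  next
    case False
    then show ?thesis using that \<xi> by (intro Max_ge bsc_phi_in) auto
  qed
  then have "bsc_Phi x \<xi> \<le> integral {0..\<xi>} (\<lambda>_. ?M)"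
    unfolding bsc_Phi_def using \<xi> by (intro integral_le bsc_phi_integrable) auto
  \<comment> \<open>The left side is S / 2 and the right side is \<xi> * M, so S / M is at most 2 *
    \<xi>.\<close>
  then show ?thesis
    unfolding maxfrac_weight_def w using \<xi> \<open>0 < ?M\<close> by (simp add: field_simps)
qed

section \<open>Indicator vectors\<close>

definition indicator_vec :: "bit vec \<Rightarrow> real vec" where
  "indicator_vec c = vec (dim_vec c) (\<lambda>i. if c $ i \<noteq> 0 then 1 else 0)"

lemma dim_indicator_vec [simp]: "dim_vec (indicator_vec c) = dim_vec c"
  and indicator_vec_index:
    "i < dim_vec c \<Longrightarrow> indicator_vec c $ i = (if c $ i \<noteq> 0 then 1 else 0)"
  by (simp_all add: indicator_vec_def)

lemma sum_indicator_vec: "(\<Sum>i < dim_vec c. indicator_vec c $ i) = real (hamming_weight c)"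
proof -
  have "(\<Sum>i < dim_vec c. indicator_vec c $ i) = (\<Sum>i < dim_vec c. if c $ i \<noteq> 0 then 1 else 0)"
    by (intro sum.cong) (auto simp: indicator_vec_index)
  also have "\<dots> = real (card ({..< dim_vec c} \<inter> {i. c $ i \<noteq> 0}))"
    by (simp add: sum.If_cases)
  also have "{..< dim_vec c} \<inter> {i. c $ i \<noteq> 0} = {i. i < dim_vec c \<and> c $ i \<noteq> 0}" by auto
  finally show ?thesis by (simp add: hamming_weight_def)
qed

lemma hamming_weight_pos:
  assumes "c \<noteq> 0\<^sub>v (dim_vec c)"
  shows "0 < hamming_weight c"
proof -
  obtain i where "i < dim_vec c" "c $ i \<noteq> 0" using assms by (auto simp: vec_eq_iff)
  then show ?thesis unfolding hamming_weight_def card_gt_0_iff by auto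
qed

text \<open>Squaring fixes 0 and 1, so the quotient is w^2 / w. For the zero word this reads 0 / 0,
  which is 0 in HOL.\<close>

lemma awgnc_weight_indicator_vec: "awgnc_weight (indicator_vec c) = real (hamming_weight c)"
proof -
  have "(\<Sum>i < dim_vec c. (indicator_vec c $ i)\<^sup>2) = (\<Sum>i < dim_vec c. indicator_vec c $ i)"
    by (intro sum.cong) (auto simp: indicator_vec_index)
  then show ?thesis
    by (simp add: awgnc_weight_def sum_indicator_vec power2_eq_square)
qed

lemma maxfrac_weight_indicator_vec:
  assumes "c \<noteq> 0\<^sub>v (dim_vec c)"
  shows "maxfrac_weight (indicator_vec c) = real (hamming_weight c)"
proof -
  obtain i where "i < dim_vec c" "c $ i \<noteq> 0" using assms by (auto simp: vec_eq_iff)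
  then have "Max (($) (indicator_vec c) ` {..< dim_vec c}) = 1"
    by (intro Max_eqI) (auto simp: image_iff indicator_vec_index intro!: bexI[of _ i])
  then show ?thesis by (simp add: maxfrac_weight_def sum_indicator_vec)
qed

text \<open>Up to the half point \<xi> the step function is positive and its values are components
  of the indicator, hence 1. So \<Phi>(\<xi>) = \<xi>, which must be half of the Hamming
  weight.\<close>

lemma bsc_weight_indicator_vec:
  assumes "c \<noteq> 0\<^sub>v (dim_vec c)"
  shows "bsc_weight (indicator_vec c) = real (hamming_weight c)"
proof -
  let ?x = "indicator_vec c"
  have pos: "0 < (\<Sum>i < dim_vec ?x. ?x $ i)"
    using hamming_weight_pos[OF assms] by (simp add: sum_indicator_vec)
  obtain \<xi> where half: "bsc_half_point ?x \<xi>" and w: "bsc_weight ?x = 2 * \<xi>"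
    using bsc_weight_half_point[OF pos] .
  then have \<xi>: "0 \<le> \<xi>" "\<xi> \<le> real (dim_vec ?x)" "bsc_Phi ?x \<xi> = real (hamming_weight c) / 2"
    using bsc_Phi_total[of ?x] by (auto simp: bsc_half_point_def sum_indicator_vec)
  have "bsc_phi ?x t = 1" if "0 < t" "t \<le> \<xi>" for t
  proof -
    have "0 < bsc_phi ?x t"
      using bsc_half_point_pos(2)[OF pos half] bsc_phi_antimono[of t \<xi> ?x] that \<xi> by simp
    moreover have "bsc_phi ?x t \<in> ($) ?x ` {..< dim_vec ?x}"
      using that \<xi> by (intro bsc_phi_in) auto
    ultimately show ?thesis by (auto simp: indicator_vec_index split: if_splits)
  qed
  \<comment> \<open>The integrands may differ only at 0, where \<open>bsc_phi\<close> has its dummy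
    value.\<close>
  then have "integral {0..\<xi>} (bsc_phi ?x) = integral {0..\<xi>} (\<lambda>_. 1)"
    by (intro integral_spike[of "{0}"]) auto
  then show ?thesis using \<xi> w by (simp add: bsc_Phi_def)
qed

section \<open>The fundamental cone\<close>

lemma indicator_vec_in_fundamental_cone:
  assumes "c \<in> mat_kernel H"
  shows "indicator_vec c \<in> fundamental_cone H"
proof -
  have dim: "dim_vec c = dim_col H" and ker: "H *\<^sub>v c = 0\<^sub>v (dim_row H)"
    using assms by (auto simp: mat_kernel_def)
  have check: "indicator_vec c $ l \<le> (\<Sum>i \<in> row_support H j - {l}. indicator_vec c $ i)"
    if j: "j < dim_row H" and l: "l \<in> row_support H j" for j l
  proof (cases "c $ l = 0")
    case True
    have "0 \<le> (\<Sum>i \<in> row_support H j - {l}. indicator_vec c $ i)"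
      using dim by (intro sum_nonneg) (simp add: row_support_def indicator_vec_index)
    then show ?thesis using True l dim by (simp add: row_support_def indicator_vec_index)
  next
    case False
    have fin: "finite (row_support H j)" by (simp add: row_support_def)
    have "0 = (H *\<^sub>v c) $ j" using ker j by simp
    also have "\<dots> = (\<Sum>i < dim_col H. H $$ (j, i) * c $ i)"
      using j dim by (simp add: scalar_prod_def atLeast0LessThan)
    also have "\<dots> = (\<Sum>i \<in> row_support H j. H $$ (j, i) * c $ i)"
      by (intro sum.mono_neutral_right) (auto simp: row_support_def)
    also have "\<dots> = (\<Sum>i \<in> row_support H j. c $ i)"
      by (intro sum.cong) (auto simp: row_support_def)
    also have "\<dots> = c $ l + (\<Sum>i \<in> row_support H j - {l}. c $ i)"
      using fin l by (rule sum.remove)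
    \<comment> \<open>The parity argument: a nonzero \<open>c $ l\<close> has to be cancelled in
      \<open>bit\<close>, so another position \<open>k\<close> of the check carries a 1. That
      position alone pays for the inequality at \<open>l\<close>.\<close>
    finally have "(\<Sum>i \<in> row_support H j - {l}. c $ i) \<noteq> 0" using False by auto
    then obtain k where k: "k \<in> row_support H j - {l}" "c $ k \<noteq> 0" by (meson sum.neutral)
    have "indicator_vec c $ l = indicator_vec c $ k"
      using False k l dim by (simp add: row_support_def indicator_vec_index)
    also have "\<dots> \<le> (\<Sum>i \<in> row_support H j - {l}. indicator_vec c $ i)"
      using fin k(1) dim
      by (intro member_le_sum) (simp_all add: row_support_def indicator_vec_index)
    finally show ?thesis .
  qed
  have nonneg: "0 \<le> indicator_vec c $ i" if "i < dim_col H" for i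
    using that dim by (simp add: indicator_vec_index)
  have "indicator_vec c \<in> carrier_vec (dim_col H)"
    using dim by (intro carrier_vecI) simp
  then show ?thesis
    unfolding fundamental_cone_def by (intro CollectI conjI allI impI ballI nonneg check)
qed

text \<open>Column \<open>l\<close> of \<open>H\<close> vanishes, and this column is the product of
  \<open>H\<close> with the unit vector.\<close>

lemma unit_vec_in_mat_kernel:
  fixes H :: "bit mat"
  assumes l: "l < dim_col H" and no_check: "\<And>j. j < dim_row H \<Longrightarrow> l \<notin> row_support H j"
  shows "unit_vec (dim_col H) l \<in> mat_kernel H"
proof -
  have "H *\<^sub>v unit_vec (dim_col H) l = 0\<^sub>v (dim_row H)"
    using assms by (intro eq_vecI) (auto simp: row_support_def)
  then show ?thesis by (simp add: mat_kernel_def)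
qed

lemma hamming_weight_unit_vec: "l < n \<Longrightarrow> hamming_weight (unit_vec n l) = 1"
proof -
  assume l: "l < n"
  have "unit_vec n l $ i \<noteq> (0 :: bit) \<longleftrightarrow> i = l" if "i < n" for i
    using that l by (cases "i = l") simp_all
  then have "{i. i < dim_vec (unit_vec n l :: bit vec) \<and> unit_vec n l $ i \<noteq> (0 :: bit)} = {l}"
    using l by (simp only: index_unit_vec(3)) blast
  then show ?thesis by (simp add: hamming_weight_def)
qed

lemma fundamental_cone_nonneg:
  "x \<in> fundamental_cone H \<Longrightarrow> i < dim_vec x \<Longrightarrow> 0 \<le> x $ i"
  by (auto simp: fundamental_cone_def)

text \<open>Turns nonvanishing of a cone point into the hypothesis shared by the weight estimates;
  nonnegativity excludes cancellation.\<close>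

lemma fundamental_cone_sum_pos:
  assumes "x \<in> fundamental_cone H - {0\<^sub>v (dim_col H)}"
  shows "0 < (\<Sum>i < dim_vec x. x $ i)"
proof -
  have dim: "dim_vec x = dim_col H" using assms by (auto simp: fundamental_cone_def)
  then obtain i where i: "i < dim_vec x" "x $ i \<noteq> 0" using assms by (auto simp: vec_eq_iff)
  have "0 \<le> x $ k" if "k < dim_vec x" for k
    using assms fundamental_cone_nonneg that by blast
  with i show ?thesis by (intro sum_pos2[of _ i]) (auto simp: less_le)
qed

text \<open>The maximum is attained at some coordinate, so a bound at every coordinate passes to it.
  Applied with a = 1 and a = 2.\<close>

lemma maxfrac_weight_ge:
  assumes x: "x \<in> fundamental_cone H - {0\<^sub>v (dim_col H)}"
    and le: "\<And>l. l < dim_vec x \<Longrightarrow> a * x $ l \<le> (\<Sum>i < dim_vec x. x $ i)"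
  shows "a \<le> maxfrac_weight x"
proof -
  let ?M = "Max (($) x ` {..< dim_vec x})"
  have pos: "0 < (\<Sum>i < dim_vec x. x $ i)" using fundamental_cone_sum_pos[OF x] .
  then obtain i where "i < dim_vec x" by (metis lessThan_iff not_le sum_nonpos)
  then have "?M \<in> ($) x ` {..< dim_vec x}" by (intro Max_in) auto
  then have "a * ?M \<le> (\<Sum>i < dim_vec x. x $ i)" using le by auto
  then show ?thesis
    using Max_component_pos[OF pos] by (simp add: maxfrac_weight_def field_simps)
qed

lemma one_le_maxfrac_weight:
  assumes x: "x \<in> fundamental_cone H - {0\<^sub>v (dim_col H)}"
  shows "1 \<le> maxfrac_weight x"
proof (rule maxfrac_weight_ge[OF x])
  have "\<And>i. i < dim_vec x \<Longrightarrow> 0 \<le> x $ i" using x fundamental_cone_nonneg by blast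
  then show "1 * x $ l \<le> (\<Sum>i < dim_vec x. x $ i)" if "l < dim_vec x" for l
    using that by (auto intro: member_le_sum)
qed

lemma two_le_maxfrac_weight:
  assumes x: "x \<in> fundamental_cone H - {0\<^sub>v (dim_col H)}"
    and check: "\<And>l. l < dim_col H \<Longrightarrow> \<exists>j < dim_row H. l \<in> row_support H j"
  shows "2 \<le> maxfrac_weight x"
proof (rule maxfrac_weight_ge[OF x])
  fix l assume l: "l < dim_vec x"
  have dim: "dim_vec x = dim_col H" using x by (auto simp: fundamental_cone_def)
  have nonneg: "\<And>i. i < dim_vec x \<Longrightarrow> 0 \<le> x $ i" using x fundamental_cone_nonneg by blast
  obtain j where j: "j < dim_row H" "l \<in> row_support H j" using check l dim by auto
  have "x $ l \<le> (\<Sum>i \<in> row_support H j - {l}. x $ i)"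
    using x j by (auto simp: fundamental_cone_def)
  \<comment> \<open>The other coordinates are nonnegative, so the sum may be extended beyond the
    check.\<close>
  also have "\<dots> \<le> (\<Sum>i \<in> {..< dim_vec x} - {l}. x $ i)"
    using nonneg dim by (intro sum_mono2) (auto simp: row_support_def)
  also have "\<dots> = (\<Sum>i < dim_vec x. x $ i) - x $ l"
    using l by (simp add: sum_diff1)
  finally show "2 * x $ l \<le> (\<Sum>i < dim_vec x. x $ i)" by simp
qed

section \<open>The minimum distance\<close>

text \<open>Finiteness is what makes the \<open>Min\<close> in \<open>min_distance\<close> a genuine
  minimum.\<close>

lemma finite_bit_vecs: "finite (carrier_vec n :: bit vec set)"
proof -
  have "(carrier_vec n :: bit vec set) \<subseteq> vec_of_list ` {xs. set xs \<subseteq> {0, 1} \<and> length xs = n}"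
  proof
    fix c :: "bit vec" assume "c \<in> carrier_vec n"
    then show "c \<in> vec_of_list ` {xs. set xs \<subseteq> {0, 1} \<and> length xs = n}"
      by (intro image_eqI[of _ _ "list_of_vec c"]) (auto simp: vec_list)
  qed
  then show ?thesis by (rule finite_subset) (intro finite_imageI finite_lists_length_eq, simp)
qed

lemma min_distance_le:
  assumes "C \<subseteq> carrier_vec n" "c \<in> C" "c \<noteq> 0\<^sub>v (dim_vec c)"
  shows "min_distance C \<le> hamming_weight c"
proof -
  have "finite {c \<in> C. c \<noteq> 0\<^sub>v (dim_vec c)}"
    using finite_subset[OF assms(1) finite_bit_vecs] by simp
  then show ?thesis unfolding min_distance_def using assms by (intro Min_le) auto
qed

lemma min_distance_attained:
  assumes "C \<subseteq> carrier_vec n" "c \<in> C" "c \<noteq> 0\<^sub>v (dim_vec c)"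
  obtains c' where "c' \<in> C" "c' \<noteq> 0\<^sub>v (dim_vec c')" "hamming_weight c' = min_distance C"
proof -
  let ?D = "{c \<in> C. c \<noteq> 0\<^sub>v (dim_vec c)}"
  have "finite ?D" using finite_subset[OF assms(1) finite_bit_vecs] by simp
  then have "min_distance C \<in> hamming_weight ` ?D"
    unfolding min_distance_def using assms by (intro Min_in) auto
  then show ?thesis using that by auto
qed

text \<open>If every coordinate is checked, the bound 2 on the weight covers distances up to 2.
  Otherwise the unit vector at an unchecked coordinate is a codeword, the distance is at most 1, and
  the trivial bound 1 suffices.\<close>

lemma min_distance_le_maxfrac_weight:
  assumes x: "x \<in> fundamental_cone H - {0\<^sub>v (dim_col H)}"
    and small: "min_distance (mat_kernel H) \<le> 2"
  shows "real (min_distance (mat_kernel H)) \<le> maxfrac_weight x"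
proof (cases "\<forall>l < dim_col H. \<exists>j < dim_row H. l \<in> row_support H j")
  case True
  then have "2 \<le> maxfrac_weight x" using two_le_maxfrac_weight[OF x] by blast
  then show ?thesis using small by linarith
next
  case False
  then obtain l where l: "l < dim_col H" "\<And>j. j < dim_row H \<Longrightarrow> l \<notin> row_support H j" by auto
  have "unit_vec (dim_col H) l \<noteq> (0\<^sub>v (dim_col H) :: bit vec)"
    using l(1) by (auto simp: vec_eq_iff)
  then have "min_distance (mat_kernel H) \<le> hamming_weight (unit_vec (dim_col H) l)"
    using unit_vec_in_mat_kernel[OF l]
    by (intro min_distance_le[of _ "dim_col H"]) (auto simp: mat_kernel_def)
  then have "real (min_distance (mat_kernel H)) \<le> 1"
    using hamming_weight_unit_vec[OF l(1)] by simp
  then show ?thesis using one_le_maxfrac_weight[OF x] by linarith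
qed

theorem lemma3p4:
  fixes C :: "bit vec set" and n d :: nat
  assumes "binary_linear_code n C" and "C \<noteq> {0\<^sub>v n}"
    and "d = min_distance C" and "d \<le> 2"
  shows "\<forall>m H. parity_check_matrix m n H C \<longrightarrow>
    is_min_pseudoweight awgnc_weight H (real d) \<and>
    is_min_pseudoweight bsc_weight H (real d) \<and>
    is_min_pseudoweight maxfrac_weight H (real d)"
proof (intro allI impI)
  fix m H assume "parity_check_matrix m n H C"
  then have n: "n = dim_col H" and C: "C = mat_kernel H"
    by (auto simp: parity_check_matrix_def)
  have C_carrier: "C \<subseteq> carrier_vec n" using n C by (auto simp: mat_kernel_def)
  \<comment> \<open>A code that contains 0 and differs from {0} has a nonzero word, so the minimum
    distance is attained.\<close>
  have "0\<^sub>v n \<in> C" using n by (auto simp: C mat_kernel_def)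
  then obtain c\<^sub>0 where "c\<^sub>0 \<in> C" "c\<^sub>0 \<noteq> 0\<^sub>v n" using assms(2) by blast
  moreover have "dim_vec c\<^sub>0 = n" using C_carrier \<open>c\<^sub>0 \<in> C\<close> by auto
  ultimately obtain c where c: "c \<in> C" "c \<noteq> 0\<^sub>v (dim_vec c)" "hamming_weight c = d"
    using min_distance_attained[OF C_carrier] assms(3) by metis
  have dim_c: "dim_vec c = dim_col H" using C_carrier c(1) n by auto
  have "(\<Sum>i < dim_vec c. indicator_vec c $ i) \<noteq> 0"
    using hamming_weight_pos[OF c(2)] by (simp add: sum_indicator_vec)
  then have "indicator_vec c \<noteq> 0\<^sub>v (dim_col H)" using dim_c by auto
  then have attained: "indicator_vec c \<in> fundamental_cone H - {0\<^sub>v (dim_col H)}"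
    using indicator_vec_in_fundamental_cone c(1) C by blast
  \<comment> \<open>The max-fractional bound comes first; the other two weights dominate that
    weight.\<close>
  have lower: "real d \<le> maxfrac_weight x" "real d \<le> awgnc_weight x" "real d \<le> bsc_weight x"
    if x: "x \<in> fundamental_cone H - {0\<^sub>v (dim_col H)}" for x
  proof -
    have nonneg: "\<And>i. i < dim_vec x \<Longrightarrow> 0 \<le> x $ i" using x fundamental_cone_nonneg by blast
    note pos = fundamental_cone_sum_pos[OF x]
    show "real d \<le> maxfrac_weight x"
      using min_distance_le_maxfrac_weight[OF x] assms(3,4) C by simp
    then show "real d \<le> awgnc_weight x" "real d \<le> bsc_weight x"
      using maxfrac_le_awgnc[OF nonneg pos] maxfrac_le_bsc[OF pos] by linarith+
  qed
  show "is_min_pseudoweight awgnc_weight H (real d) \<and>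
    is_min_pseudoweight bsc_weight H (real d) \<and>
    is_min_pseudoweight maxfrac_weight H (real d)"
    unfolding is_min_pseudoweight_def
    using lower attained awgnc_weight_indicator_vec[of c] bsc_weight_indicator_vec[OF c(2)]
      maxfrac_weight_indicator_vec[OF c(2)] c(3) by blast
qed

end
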